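(* Let $r$ be a relation over a schema context on $U$, let $g$ be a reality and let $x,y\in L_U$. Then $L_r\models_g g(x)\to g(y)$ if and only if $L_r\models \pi_g(x)\to\pi_g(y)$.
   Context: A relation scheme is a finite set $U=\{A_1,\dots,A_n\}$ of attributes with domains $\mathrm{dom}(A)$. A schema context assigns to each $A$ a finite lattice $L_A$ (bottom $0_A$, top $1_A$) and a surjective comparability function $f_A:\mathrm{dom}(A)^2\to L_A$ with $f_A(u,u)=1_A$, $f_A(u,v)=f_A(v,u)$. $L_U=\prod_A L_A$ (componentwise order). A relation $r$ is a finite set of tuples; $f_U(t_1,t_2)=\langle f_{A_i}(t_1[A_i],t_2[A_i])\rangle_i$, $f_U(r)=\{f_U(t_1,t_2):t_1,t_2\in r\}$, $L_r=\{\bigwedge T: T\subseteq f_U(r)\}$ (empty meet = top). An attribute interpretation is an increasing $h_A:L_A\to\{0,1\}$ with $h_A(0_A)=0,h_A(1_A)=1$; a schema interpretation is $g(z)=\langle h_{A_1}(z[A_1]),\dots,h_{A_n}(z[A_n])\rangle$, identified with a subset of $U$. A reality is a schema interpretation that is a $\wedge$-homomorphism into $\{0,1\}^n$. $L_r\models_g g(x)\to g(y)$ means: for every $z\in L_r$, $g(x)\subseteq g(z)$ implies $g(y)\subseteq g(z)$. $L_r\models u\to v$ (for $u,v\in L_U$) means: for every $z\in L_r$, $u\le z$ implies $v\le z$. For a reality $g$, $x_g\in L_U$ has $x_g[A]=$ the least element of $\{x_A\in L_A: h_A(x_A)=1\}$, and $\pi_g(x)[A]=x_g[A]$ if $x[A]\ge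 x_g[A]$, $\pi_g(x)[A]=0_A$ otherwise. *)

theory Defs
  imports "HOL-Algebra.Lattice"
begin

text \<open>
  The domains of all attributes live in one type \<open>'d\<close> and the lattices of all attributes in one
  type \<open>'l\<close>; the sets \<open>D A\<close> and the orders \<open>L A\<close> (carriers included) still vary with \<open>A\<close>.
  Boundedness makes every \<open>L A\<close>, hence by surjectivity every \<open>D A\<close>, nonempty.
\<close>

locale schema_context =
  fixes U :: "'a set"
    and D :: "'a \<Rightarrow> 'd set"
    and L :: "'a \<Rightarrow> 'l gorder"
    and f :: "'a \<Rightarrow> 'd \<Rightarrow> 'd \<Rightarrow> 'l"
  assumes finite_U: "finite U"
    and bounded_lattice_L: "A \<in> U \<Longrightarrow> Lattice.bounded_lattice (L A)"
    and finite_L: "A \<in> U \<Longrightarrow> finite (carrier (L A))"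
    and f_surj: "A \<in> U \<Longrightarrow> (\<lambda>(u, v). f A u v) ` (D A \<times> D A) = carrier (L A)"
    and f_refl: "A \<in> U \<Longrightarrow> u \<in> D A \<Longrightarrow> f A u u = \<top>\<^bsub>L A\<^esub>"
    and f_sym: "A \<in> U \<Longrightarrow> u \<in> D A \<Longrightarrow> v \<in> D A \<Longrightarrow> f A u v = f A v u"

definition product_order :: "'a set \<Rightarrow> ('a \<Rightarrow> 'l gorder) \<Rightarrow> ('a \<Rightarrow> 'l) gorder" where
  "product_order U L =
     \<lparr>carrier = (\<Pi>\<^sub>E A\<in>U. carrier (L A)), eq = (=), le = (\<lambda>x y. \<forall>A\<in>U. x A \<sqsubseteq>\<^bsub>L A\<^esub> y A)\<rparr>"

definition is_relation :: "'a set \<Rightarrow> ('a \<Rightarrow> 'd set) \<Rightarrow> ('a \<Rightarrow> 'd) set \<Rightarrow> bool" where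
  "is_relation U D r \<longleftrightarrow> finite r \<and> r \<subseteq> (\<Pi>\<^sub>E A\<in>U. D A)"

definition tuple_comp ::
    "'a set \<Rightarrow> ('a \<Rightarrow> 'd \<Rightarrow> 'd \<Rightarrow> 'l) \<Rightarrow> ('a \<Rightarrow> 'd) \<Rightarrow> ('a \<Rightarrow> 'd) \<Rightarrow> 'a \<Rightarrow> 'l" where
  "tuple_comp U f t1 t2 = (\<lambda>A\<in>U. f A (t1 A) (t2 A))"

definition relation_comp ::
    "'a set \<Rightarrow> ('a \<Rightarrow> 'd \<Rightarrow> 'd \<Rightarrow> 'l) \<Rightarrow> ('a \<Rightarrow> 'd) set \<Rightarrow> ('a \<Rightarrow> 'l) set" where
  "relation_comp U f r = {tuple_comp U f t1 t2 | t1 t2. t1 \<in> r \<and> t2 \<in> r}"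

text \<open>The case \<open>T = {}\<close> contributes the top element of the product.\<close>

definition relation_lattice ::
    "'a set \<Rightarrow> ('a \<Rightarrow> 'l gorder) \<Rightarrow> ('a \<Rightarrow> 'd \<Rightarrow> 'd \<Rightarrow> 'l) \<Rightarrow> ('a \<Rightarrow> 'd) set \<Rightarrow> ('a \<Rightarrow> 'l) set" where
  "relation_lattice U L f r =
     {\<Sqinter>\<^bsub>product_order U L\<^esub> T | T. T \<subseteq> relation_comp U f r}"

text \<open>The two-element lattice \<open>{0,1}\<close> is \<^typ>\<open>bool\<close>.\<close>

definition attribute_interpretation :: "'l gorder \<Rightarrow> ('l \<Rightarrow> bool) \<Rightarrow> bool" where
  "attribute_interpretation K h \<longleftrightarrow>
     (\<forall>a\<in>carrier K. \<forall>b\<in>carrier K. a \<sqsubseteq>\<^bsub>K\<^esub> b \<longrightarrow> h a \<le> h b) \<and>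
     h \<bottom>\<^bsub>K\<^esub> = False \<and> h \<top>\<^bsub>K\<^esub> = True"

text \<open>
  A schema interpretation is given by its family \<open>h\<close> of attribute interpretations;
  \<open>interpret_set U h\<close> is the map \<open>g\<close> itself, with the elements of \<open>{0,1}\<^sup>n\<close> read as subsets
  of \<open>U\<close>, so that the componentwise order and meet become inclusion and intersection.
\<close>

definition schema_interpretation ::
    "'a set \<Rightarrow> ('a \<Rightarrow> 'l gorder) \<Rightarrow> ('a \<Rightarrow> 'l \<Rightarrow> bool) \<Rightarrow> bool" where
  "schema_interpretation U L h \<longleftrightarrow> (\<forall>A\<in>U. attribute_interpretation (L A) (h A))"

definition interpret_set :: "'a set \<Rightarrow> ('a \<Rightarrow> 'l \<Rightarrow> bool) \<Rightarrow> ('a \<Rightarrow> 'l) \<Rightarrow> 'a set" where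
  "interpret_set U h z = {A \<in> U. h A (z A)}"

definition reality :: "'a set \<Rightarrow> ('a \<Rightarrow> 'l gorder) \<Rightarrow> ('a \<Rightarrow> 'l \<Rightarrow> bool) \<Rightarrow> bool" where
  "reality U L h \<longleftrightarrow> schema_interpretation U L h \<and>
     (\<forall>z\<in>carrier (product_order U L). \<forall>w\<in>carrier (product_order U L).
        interpret_set U h (z \<sqinter>\<^bsub>product_order U L\<^esub> w) = interpret_set U h z \<inter> interpret_set U h w)"

definition models_interp ::
    "('a \<Rightarrow> 'l) set \<Rightarrow> (('a \<Rightarrow> 'l) \<Rightarrow> 'a set) \<Rightarrow> 'a set \<Rightarrow> 'a set \<Rightarrow> bool" where
  "models_interp Lr g X Y \<longleftrightarrow> (\<forall>z\<in>Lr. X \<subseteq> g z \<longrightarrow> Y \<subseteq> g z)"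

definition models_impl ::
    "'a set \<Rightarrow> ('a \<Rightarrow> 'l gorder) \<Rightarrow> ('a \<Rightarrow> 'l) set \<Rightarrow> ('a \<Rightarrow> 'l) \<Rightarrow> ('a \<Rightarrow> 'l) \<Rightarrow> bool" where
  "models_impl U L Lr u v \<longleftrightarrow>
     (\<forall>z\<in>Lr. u \<sqsubseteq>\<^bsub>product_order U L\<^esub> z \<longrightarrow> v \<sqsubseteq>\<^bsub>product_order U L\<^esub> z)"

text \<open>The least element below exists whenever \<open>h\<close> is a reality.\<close>

definition reality_threshold ::
    "'a set \<Rightarrow> ('a \<Rightarrow> 'l gorder) \<Rightarrow> ('a \<Rightarrow> 'l \<Rightarrow> bool) \<Rightarrow> 'a \<Rightarrow> 'l" where
  "reality_threshold U L h =
     (\<lambda>A\<in>U. THE a. least (L A) a {b \<in> carrier (L A). h A b})"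

definition reality_proj ::
    "'a set \<Rightarrow> ('a \<Rightarrow> 'l gorder) \<Rightarrow> ('a \<Rightarrow> 'l \<Rightarrow> bool) \<Rightarrow> ('a \<Rightarrow> 'l) \<Rightarrow> 'a \<Rightarrow> 'l" where
  "reality_proj U L h x =
     (\<lambda>A\<in>U. if reality_threshold U L h A \<sqsubseteq>\<^bsub>L A\<^esub> x A then reality_threshold U L h A
            else \<bottom>\<^bsub>L A\<^esub>)"

end

theory Submission
  imports Defs
begin

text \<open>
  Since \<open>g\<close> preserves meets, each \<open>h A\<close> is the indicator of the principal filter generated by
  \<open>x\<^sub>g A\<close>. Hence, for all \<open>x\<close> and \<open>z\<close> in the product lattice, \<open>\<pi>\<^sub>g x \<sqsubseteq> z\<close> holds iff
  \<open>g x \<subseteq> g z\<close>, and the two notions of implication agree on every set of such \<open>z\<close>.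
\<close>

text \<open>The empty set is included because \<open>relation_lattice\<close> admits the empty meet:
  all carrier elements are lower bounds of \<open>{}\<close>, so the chosen infimum is top.\<close>

lemma (in weak_bounded_lattice) finite_is_glb_inf:
  assumes "finite F" and "F \<subseteq> carrier L"
  shows "is_glb L (\<Sqinter>F) F"
proof (cases "F = {}")
  case True
  then show ?thesis
    using top_greatest by (simp add: Lattice.inf_def top_def)
next
  case False
  then show ?thesis
    using assms by (simp add: finite_inf_greatest)
qed

lemma product_order_simps [simp]:
  "carrier (product_order U L) = (\<Pi>\<^sub>E A\<in>U. carrier (L A))"
  "x \<sqsubseteq>\<^bsub>product_order U L\<^esub> y \<longleftrightarrow> (\<forall>A\<in>U. x A \<sqsubseteq>\<^bsub>L A\<^esub> y A)"
  by (simp_all add: product_order_def)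

text \<open>Lower bounds in the product are tested coordinate by coordinate. Restricting
  \<open>s\<close> to \<open>U\<close> makes the result extensional, as membership in the carrier
  demands.\<close>

lemma product_order_is_glb:
  assumes T: "T \<subseteq> carrier (product_order U L)"
    and glb: "\<And>A. A \<in> U \<Longrightarrow> is_glb (L A) (s A) ((\<lambda>t. t A) ` T)"
  shows "is_glb (product_order U L) (\<lambda>A\<in>U. s A) T"
proof (rule greatest_LowerI)
  fix t assume "t \<in> T"
  moreover have "(\<lambda>t. t A) ` T \<subseteq> carrier (L A)" if "A \<in> U" for A
    using T that by auto
  ultimately show "(\<lambda>A\<in>U. s A) \<sqsubseteq>\<^bsub>product_order U L\<^esub> t"
    using greatest_Lower_below[OF glb] by simp
next
  fix y assume y: "y \<in> Lower (product_order U L) T"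
  have "y A \<sqsubseteq>\<^bsub>L A\<^esub> s A" if A: "A \<in> U" for A
  proof (rule greatest_le[OF glb[OF A]])
    show "y A \<in> Lower (L A) ((\<lambda>t. t A) ` T)"
      using y T A by (auto simp: Lower_def)
  qed
  then show "y \<sqsubseteq>\<^bsub>product_order U L\<^esub> (\<lambda>A\<in>U. s A)"
    by simp
next
  show "(\<lambda>A\<in>U. s A) \<in> carrier (product_order U L)"
    using greatest_closed[OF glb] by simp
qed (fact T)

text \<open>Antisymmetry in each factor gives agreement on \<open>U\<close>, and extensionality of
  carrier elements gives equality of functions.\<close>

lemma product_order_glb_unique:
  assumes po: "\<And>A. A \<in> U \<Longrightarrow> partial_order (L A)"
    and u: "is_glb (product_order U L) u T" and v: "is_glb (product_order U L) v T"
  shows "u = v"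
proof (rule PiE_ext)
  show u': "u \<in> (\<Pi>\<^sub>E A\<in>U. carrier (L A))" and v': "v \<in> (\<Pi>\<^sub>E A\<in>U. carrier (L A))"
    using greatest_closed[OF u] greatest_closed[OF v] by simp_all
  fix A assume A: "A \<in> U"
  have "u \<sqsubseteq>\<^bsub>product_order U L\<^esub> v" "v \<sqsubseteq>\<^bsub>product_order U L\<^esub> u"
    by (rule greatest_le[OF v greatest_mem[OF u]], rule greatest_le[OF u greatest_mem[OF v]])
  then show "u A = v A"
    using partial_order.le_antisym[OF po[OF A]] u' v' A by (auto simp: PiE_iff)
qed

text \<open>The infimum is a \<open>SOME\<close>-choice of a greatest lower bound. The componentwise
  meet is one, and uniqueness forces the choice to be it.\<close>

lemma product_order_inf_eq:
  assumes bl: "\<And>A. A \<in> U \<Longrightarrow> bounded_lattice (L A)"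
    and T: "finite T" "T \<subseteq> carrier (product_order U L)"
  shows "\<Sqinter>\<^bsub>product_order U L\<^esub> T = (\<lambda>A\<in>U. \<Sqinter>\<^bsub>L A\<^esub> ((\<lambda>t. t A) ` T))"
proof -
  have po: "partial_order (L A)" if "A \<in> U" for A
    using bl[OF that] by (simp add: bounded_lattice_def lattice_def upper_semilattice_def)
  have "is_glb (L A) (\<Sqinter>\<^bsub>L A\<^esub> ((\<lambda>t. t A) ` T)) ((\<lambda>t. t A) ` T)" if A: "A \<in> U" for A
  proof -
    interpret bounded_lattice "L A"
      by (rule bl[OF A])
    show ?thesis
      using T A by (intro finite_is_glb_inf) auto
  qed
  then have glb: "is_glb (product_order U L) (\<lambda>A\<in>U. \<Sqinter>\<^bsub>L A\<^esub> ((\<lambda>t. t A) ` T)) T"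
    by (rule product_order_is_glb[OF T(2)])
  then show ?thesis
    unfolding Lattice.inf_def[of "product_order U L"]
    by (intro some_equality product_order_glb_unique[OF po])
qed

lemma product_order_inf_closed:
  assumes bl: "\<And>A. A \<in> U \<Longrightarrow> bounded_lattice (L A)"
    and T: "finite T" "T \<subseteq> carrier (product_order U L)"
  shows "\<Sqinter>\<^bsub>product_order U L\<^esub> T \<in> carrier (product_order U L)"
proof -
  have "\<Sqinter>\<^bsub>L A\<^esub> ((\<lambda>t. t A) ` T) \<in> carrier (L A)" if A: "A \<in> U" for A
  proof -
    interpret bounded_lattice "L A"
      by (rule bl[OF A])
    have "is_glb (L A) (\<Sqinter>\<^bsub>L A\<^esub> ((\<lambda>t. t A) ` T)) ((\<lambda>t. t A) ` T)"
      using T A by (intro finite_is_glb_inf) auto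
    then show ?thesis
      by (rule greatest_closed)
  qed
  then show ?thesis
    by (simp add: product_order_inf_eq[OF bl T])
qed

text \<open>This places every \<open>z\<close> tested by the two implications in the product
  lattice. Since \<open>r\<close> is finite, only finite meets occur.\<close>

lemma relation_lattice_subset_carrier:
  assumes "schema_context U D L f" and r: "is_relation U D r"
  shows "relation_lattice U L f r \<subseteq> carrier (product_order U L)"
proof -
  interpret schema_context U D L f
    by fact
  have "relation_comp U f r = (\<lambda>(t1, t2). tuple_comp U f t1 t2) ` (r \<times> r)"
    by (auto simp: relation_comp_def)
  then have fin: "finite (relation_comp U f r)"
    using r by (simp add: is_relation_def)
  have "f A (t1 A) (t2 A) \<in> carrier (L A)" if "t1 \<in> r" "t2 \<in> r" "A \<in> U" for t1 t2 A
  proof -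
    have "t1 A \<in> D A" "t2 A \<in> D A"
      using r that by (auto simp: is_relation_def)
    then show ?thesis
      using f_surj[OF \<open>A \<in> U\<close>] by auto
  qed
  then have sub: "relation_comp U f r \<subseteq> carrier (product_order U L)"
    by (auto simp: relation_comp_def tuple_comp_def)
  have "\<Sqinter>\<^bsub>product_order U L\<^esub> T \<in> carrier (product_order U L)" if "T \<subseteq> relation_comp U f r" for T
    using that fin sub bounded_lattice_L
    by (intro product_order_inf_closed) (auto intro: finite_subset)
  then show ?thesis
    by (auto simp: relation_lattice_def)
qed

text \<open>A reality preserves meets of whole tuples. To isolate attribute \<open>A\<close>, embed
  \<open>a\<close> and \<open>b\<close> into tuples at coordinate \<open>A\<close> and compare both
  sides there.\<close>

lemma reality_attribute_meet:
  assumes bl: "\<And>A. A \<in> U \<Longrightarrow> bounded_lattice (L A)"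
    and reality: "reality U L h" and A: "A \<in> U"
    and a: "a \<in> carrier (L A)" and b: "b \<in> carrier (L A)"
  shows "h A (a \<sqinter>\<^bsub>L A\<^esub> b) \<longleftrightarrow> h A a \<and> h A b"
proof -
  \<comment> \<open>Top fills the other coordinates so that the tuple lies in the product; only
    coordinate \<open>A\<close> is read off.\<close>
  let ?e = "\<lambda>c. \<lambda>B\<in>U. if B = A then c else \<top>\<^bsub>L B\<^esub>"
  have e: "?e c \<in> carrier (product_order U L)" if "c \<in> carrier (L A)" for c
  proof -
    have "\<top>\<^bsub>L B\<^esub> \<in> carrier (L B)" if "B \<in> U" for B
    proof -
      interpret bounded_lattice "L B"
        by (rule bl[OF that])
      show ?thesis
        by simp
    qed
    then show ?thesis
      using that by auto
  qed
  have "{?e a, ?e b} \<subseteq> carrier (product_order U L)"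
    using e[OF a] e[OF b] by simp
  from product_order_inf_eq[OF bl _ this]
  have meet: "(?e a \<sqinter>\<^bsub>product_order U L\<^esub> ?e b) A = a \<sqinter>\<^bsub>L A\<^esub> b"
    using A by (simp add: meet_def)
  have "interpret_set U h (?e a \<sqinter>\<^bsub>product_order U L\<^esub> ?e b) =
      interpret_set U h (?e a) \<inter> interpret_set U h (?e b)"
    using reality e[OF a] e[OF b] unfolding reality_def by blast
  then have "A \<in> interpret_set U h (?e a \<sqinter>\<^bsub>product_order U L\<^esub> ?e b) \<longleftrightarrow>
      A \<in> interpret_set U h (?e a) \<and> A \<in> interpret_set U h (?e b)"
    by simp
  with meet show ?thesis
    using A by (simp add: interpret_set_def)
qed

text \<open>The set of \<open>b\<close> with \<open>h A b\<close> is a nonempty finite set closed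
  under binary meets, so it contains a lower bound of itself.\<close>

lemma reality_threshold_least:
  assumes "schema_context U D L f" and reality: "reality U L h" and A: "A \<in> U"
  shows "least (L A) (reality_threshold U L h A) {b \<in> carrier (L A). h A b}"
proof -
  interpret schema_context U D L f
    by fact
  interpret K: bounded_lattice "L A"
    by (rule bounded_lattice_L[OF A])
  let ?S = "{b \<in> carrier (L A). h A b}"
  \<comment> \<open>Stated for all finite subsets so that induction can add one element at a time,
    replacing the bound \<open>b\<close> by its meet with the new element.\<close>
  have "\<exists>b\<in>?S. \<forall>c\<in>F. b \<sqsubseteq>\<^bsub>L A\<^esub> c" if "finite F" "F \<subseteq> ?S" for F
    using that
  proof (induction F rule: finite_induct)
    case empty
    have "\<top>\<^bsub>L A\<^esub> \<in> ?S"
      using reality A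
      by (simp add: reality_def schema_interpretation_def attribute_interpretation_def)
    then show ?case
      by blast
  next
    case (insert a F)
    then obtain b where b: "b \<in> ?S" "\<forall>c\<in>F. b \<sqsubseteq>\<^bsub>L A\<^esub> c"
      by auto
    have a: "a \<in> ?S"
      using insert.prems by simp
    have "a \<sqinter>\<^bsub>L A\<^esub> b \<sqsubseteq>\<^bsub>L A\<^esub> c" if c: "c \<in> F" for c
    proof (rule K.le_trans)
      show "a \<sqinter>\<^bsub>L A\<^esub> b \<sqsubseteq>\<^bsub>L A\<^esub> b" "b \<sqsubseteq>\<^bsub>L A\<^esub> c"
        using a b c by (auto intro: K.meet_right)
    qed (use a b c insert.prems in auto)
    moreover have "a \<sqinter>\<^bsub>L A\<^esub> b \<in> ?S"
      using a b reality_attribute_meet[OF bounded_lattice_L reality A] by simp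
    ultimately show ?case
      using a b by (intro bexI[of _ "a \<sqinter>\<^bsub>L A\<^esub> b"]) (auto intro: K.meet_left)
  qed
  \<comment> \<open>For \<open>F = ?S\<close> the bound lies in the set that it bounds, hence is
    least.\<close>
  from this[of ?S] obtain m where "least (L A) m ?S"
    using finite_L[OF A] by (auto simp: least_def)
  \<comment> \<open>Antisymmetry in \<open>L A\<close> makes the least element unique, so
    \<open>THE\<close> denotes it.\<close>
  then have "least (L A) (THE a. least (L A) a ?S) ?S"
    by (rule theI) (rule K.least_unique[OF _ \<open>least (L A) m ?S\<close>])
  then show ?thesis
    using A by (simp add: reality_threshold_def)
qed

text \<open>From right to left this is leastness of the threshold; from left to right it is
  monotonicity of \<open>h A\<close>.\<close>

lemma reality_threshold_le_iff:
  assumes "schema_context U D L f" and reality: "reality U L h"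
    and A: "A \<in> U" and a: "a \<in> carrier (L A)"
  shows "reality_threshold U L h A \<sqsubseteq>\<^bsub>L A\<^esub> a \<longleftrightarrow> h A a"
proof
  note least = reality_threshold_least[OF assms(1-3)]
  show "reality_threshold U L h A \<sqsubseteq>\<^bsub>L A\<^esub> a" if "h A a"
    using least_le[OF least] a that by simp
  show "h A a" if "reality_threshold U L h A \<sqsubseteq>\<^bsub>L A\<^esub> a"
    using that least_mem[OF least] reality A a
    by (auto simp: reality_def schema_interpretation_def attribute_interpretation_def le_bool_def)
qed

text \<open>Compare at each \<open>A\<close>. If \<open>h A (x A)\<close> holds, the projection has
  the threshold there, and lying below \<open>z A\<close> means \<open>h A (z A)\<close>. Otherwise
  it has bottom there, and both sides hold trivially.\<close>

lemma reality_proj_le_iff: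
  assumes sc: "schema_context U D L f" and reality: "reality U L h"
    and x: "x \<in> carrier (product_order U L)" and z: "z \<in> carrier (product_order U L)"
  shows "reality_proj U L h x \<sqsubseteq>\<^bsub>product_order U L\<^esub> z \<longleftrightarrow>
         interpret_set U h x \<subseteq> interpret_set U h z"
proof -
  have "reality_proj U L h x A \<sqsubseteq>\<^bsub>L A\<^esub> z A \<longleftrightarrow> (h A (x A) \<longrightarrow> h A (z A))" if A: "A \<in> U" for A
  proof -
    interpret bounded_lattice "L A"
      by (rule schema_context.bounded_lattice_L[OF sc A])
    have "x A \<in> carrier (L A)" "z A \<in> carrier (L A)"
      using x z A by auto
    then show ?thesis
      using A by (simp add: reality_proj_def reality_threshold_le_iff[OF sc reality A])
  qed
  then show ?thesis
    by (auto simp: interpret_set_def)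
qed

theorem theorem2:
  fixes U :: "'a set"
    and D :: "'a \<Rightarrow> 'd set"
    and L :: "'a \<Rightarrow> 'l gorder"
    and f :: "'a \<Rightarrow> 'd \<Rightarrow> 'd \<Rightarrow> 'l"
    and r :: "('a \<Rightarrow> 'd) set"
    and h :: "'a \<Rightarrow> 'l \<Rightarrow> bool"
    and x y :: "'a \<Rightarrow> 'l"
  assumes "schema_context U D L f"
    and "is_relation U D r"
    and "reality U L h"
    and "x \<in> carrier (product_order U L)"
    and "y \<in> carrier (product_order U L)"
  shows "models_interp (relation_lattice U L f r) (interpret_set U h)
             (interpret_set U h x) (interpret_set U h y) \<longleftrightarrow>
         models_impl U L (relation_lattice U L f r)
             (reality_proj U L h x) (reality_proj U L h y)"
proof -
  \<comment> \<open>Used with \<open>u = x\<close> for the premises and \<open>u = y\<close> for the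
    conclusions of the two implications.\<close>
  have "reality_proj U L h u \<sqsubseteq>\<^bsub>product_order U L\<^esub> z \<longleftrightarrow>
      interpret_set U h u \<subseteq> interpret_set U h z"
    if "u \<in> carrier (product_order U L)" "z \<in> relation_lattice U L f r" for u z
    using reality_proj_le_iff[OF assms(1,3)] relation_lattice_subset_carrier[OF assms(1,2)] that
    by blast
  then show ?thesis
    using assms(4,5) unfolding models_interp_def models_impl_def by blast
qed

end
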